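(* Consider the additive noise latent causal model described in the context. For each node $i\in[n]$ consider the following system of equations in $c\in\mathbb R^n$: $$c_i-c^\top\nabla_z f_{p,i}(\varphi)=0\quad\text{and}\quad c_i-c^\top\nabla_z f_{q,i}(\varphi)=0,\qquad \forall \varphi\in\mathbb R^{|\mathrm{pa}(i)|}. \qquad ( * )$$ Then the following are equivalent: (a) for every $i\in[n]$ and every $c\in\mathcal C_i$, it is not the case that $c^\top s_Z(Z)=c^\top s_Z^{m_i}(Z)$ almost surely under $Z\sim p_Z$; (b) for every $i\in[n]$, every solution $c$ of $( * )$ satisfies $c\notin\mathcal C_i$, i.e. $c_j=0$ for all $j\in\overline{\mathrm{pa}}(i)$.
   Context: $Z=(Z_1,\dots,Z_n)^\top$ is a random vector with density $p_Z$ on $\mathbb R^n$, $p_Z(z)\ne0$ for all $z$, factorizing along a DAG on $[n]=\{1,\dots,n\}$: $p_Z(z)=\prod_i p_Z(z_i\mid z_{\mathrm{pa}(i)})$, where $\mathrm{pa}(i)$ is the set of parents of $i$ and $\overline{\mathrm{pa}}(i)=\mathrm{pa}(i)\cup\{i\}$. For each $i$ there is an interventional conditional density $q_Z(z_i\mid z_{\mathrm{pa}(i)})$ different from $p_Z(z_i\mid z_{\mathrm{pa}(i)})$. All conditional densities are positive and continuously differentiable in all variables. Additive noise model: the observational and interventional mechanisms of node $i$ are, respectively, $Z_i=f_{p,i}(Z_{\mathrm{pa}(i)})+N_{p,i}$ and $Z_i=f_{q,i}(Z_{\mathrm{pa}(i)})+N_{q,i}$, with $f_{p,i},f_{q,i}:\mathbb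 R^{|\mathrm{pa}(i)|}\to\mathbb R$ continuously differentiable and noise terms $N_{p,i}$, $N_{q,i}$, independent of $Z_{\mathrm{pa}(i)}$, whose pdfs are analytic; i.e. $p_Z(z_i\mid z_{\mathrm{pa}(i)})=h_{p,i}(z_i-f_{p,i}(z_{\mathrm{pa}(i)}))$ and $q_Z(z_i\mid z_{\mathrm{pa}(i)})=h_{q,i}(z_i-f_{q,i}(z_{\mathrm{pa}(i)}))$, with $h_{p,i},h_{q,i}$ the noise pdfs. $\varphi$ stands for $z_{\mathrm{pa}(i)}$, and $\nabla_z f_{p,i}(\varphi)\in\mathbb R^n$ is the gradient with respect to all of $z$ (its coordinates outside $\mathrm{pa}(i)$ are zero); likewise for $f_{q,i}$. Environments: each node $i$ is intervened in exactly one environment $m_i$, in which only node $i$ is intervened; the latent density there is $p^{m_i}(z)=q_Z(z_i\mid z_{\mathrm{pa}(i)})\prod_{j\neq i}p_Z(z_j\mid z_{\mathrm{pa}(j)})$. Scores: $s_Z=\nabla_z\log p_Z$, $s_Z^{m_i}=\nabla_z\log p^{m_i}$. $\mathcal C_i=\{c\in\mathbb R^n:\exists j\in\overline{\mathrm{pa}}(i)\text{ such that }c_j\ne0\}$.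
   Formalization: "q_Z(z_i|z_pa(i)) different from p_Z(z_i|z_pa(i))" is taken to mean that they differ, as densities in z_i, for a dense set of parent values; if they merely differ as functions, the equivalence fails, since both mechanisms may coincide on an open set of parent values. *)

theory Defs
  imports "HOL-Probability.Probability"
begin

definition real_analytic :: "(real \<Rightarrow> real) \<Rightarrow> bool" where
  "real_analytic h \<longleftrightarrow>
     (\<forall>x. \<exists>r>0. \<exists>a. \<forall>y. \<bar>y - x\<bar> < r \<longrightarrow> (\<lambda>k. a k * (y - x) ^ k) sums h y)"

definition pdf_on_real :: "(real \<Rightarrow> real) \<Rightarrow> bool" where
  "pdf_on_real h \<longleftrightarrow>
     h \<in> borel_measurable borel \<and> (\<forall>x. 0 \<le> h x) \<and> (\<integral>\<^sup>+ x. ennreal (h x) \<partial>lborel) = 1"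

definition cont_diff :: "(real ^ 'n::finite \<Rightarrow> real) \<Rightarrow> bool" where
  "cont_diff f \<longleftrightarrow> (\<exists>g. (\<forall>z. GDERIV f z :> g z) \<and> continuous_on UNIV g)"

(* Unspecified at points where f is not differentiable. *)
definition grad :: "(real ^ 'n::finite \<Rightarrow> real) \<Rightarrow> real ^ 'n \<Rightarrow> real ^ 'n" where
  "grad f z = (THE D. GDERIV f z :> D)"

(* A function of the coordinates in S only; this is how functions on \<real>\<^sup>S are represented,
   so that their gradients are taken with respect to all coordinates. *)
definition depends_only_on :: "'n set \<Rightarrow> (real ^ 'n::finite \<Rightarrow> real) \<Rightarrow> bool" where
  "depends_only_on S f \<longleftrightarrow> (\<forall>z z'. (\<forall>j\<in>S. z $ j = z' $ j) \<longrightarrow> f z = f z')"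

(* The conditional density of z_i given its parents under the mechanism Z_i = f_i(Z_pa(i)) + N_i,
   where N_i has density h_i. *)
definition cond_density ::
    "('n \<Rightarrow> real ^ 'n \<Rightarrow> real) \<Rightarrow> ('n \<Rightarrow> real \<Rightarrow> real) \<Rightarrow> 'n::finite \<Rightarrow> real ^ 'n \<Rightarrow> real" where
  "cond_density f h i z = h i (z $ i - f i z)"

definition obs_density ::
    "('n \<Rightarrow> real ^ 'n \<Rightarrow> real) \<Rightarrow> ('n \<Rightarrow> real \<Rightarrow> real) \<Rightarrow> real ^ 'n::finite \<Rightarrow> real" where
  "obs_density fp hp z = (\<Prod>i\<in>UNIV. cond_density fp hp i z)"

(* The density in the environment in which exactly node i is intervened; environments are
   identified with their targets. *)
definition int_density ::
    "('n \<Rightarrow> real ^ 'n \<Rightarrow> real) \<Rightarrow> ('n \<Rightarrow> real ^ 'n \<Rightarrow> real) \<Rightarrow>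
     ('n \<Rightarrow> real \<Rightarrow> real) \<Rightarrow> ('n \<Rightarrow> real \<Rightarrow> real) \<Rightarrow> 'n::finite \<Rightarrow> real ^ 'n \<Rightarrow> real" where
  "int_density fp fq hp hq i z =
     cond_density fq hq i z * (\<Prod>j\<in>UNIV - {i}. cond_density fp hp j z)"

definition score :: "(real ^ 'n::finite \<Rightarrow> real) \<Rightarrow> real ^ 'n \<Rightarrow> real ^ 'n" where
  "score p = grad (\<lambda>z. ln (p z))"

definition pa_coeff_vectors :: "('n \<Rightarrow> 'n set) \<Rightarrow> 'n::finite \<Rightarrow> (real ^ 'n) set" where
  "pa_coeff_vectors pa i = {c. \<exists>j\<in>insert i (pa i). c $ j \<noteq> 0}"

definition solves_system ::
    "('n \<Rightarrow> real ^ 'n \<Rightarrow> real) \<Rightarrow> ('n \<Rightarrow> real ^ 'n \<Rightarrow> real) \<Rightarrow> 'n::finite \<Rightarrow> real ^ 'n \<Rightarrow> bool" where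
  "solves_system fp fq i c \<longleftrightarrow>
     (\<forall>\<phi>. c $ i - c \<bullet> grad (fp i) \<phi> = 0 \<and> c $ i - c \<bullet> grad (fq i) \<phi> = 0)"

locale additive_noise_model = prob_space M for M :: "'w measure" +
  fixes Z :: "'w \<Rightarrow> real ^ 'n::finite"
    and pa :: "'n \<Rightarrow> 'n set"
    and fp fq :: "'n \<Rightarrow> real ^ 'n \<Rightarrow> real"
    and hp hq :: "'n \<Rightarrow> real \<Rightarrow> real"
  assumes dag: "acyclic {(j, i). j \<in> pa i}"
    and fp_parents: "depends_only_on (pa i) (fp i)"
    and fq_parents: "depends_only_on (pa i) (fq i)"
    and fp_C1: "cont_diff (fp i)"
    and fq_C1: "cont_diff (fq i)"
    and hp_pdf: "pdf_on_real (hp i)"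
    and hq_pdf: "pdf_on_real (hq i)"
    and hp_analytic: "real_analytic (hp i)"
    and hq_analytic: "real_analytic (hq i)"
    and p_pos: "cond_density fp hp i z > 0"
    and q_pos: "cond_density fq hq i z > 0"
    and p_C1: "cont_diff (cond_density fp hp i)"
    and q_C1: "cont_diff (cond_density fq hq i)"
    (* For a dense set of parent values the two conditional densities differ as densities of z_i.
       Differing at a single point would not suffice for the characterization by the linear
       system: as the f's are merely C1, both mechanisms could coincide on an open set of
       parent values, while elsewhere the equations of the system hold. *)
    and p_q_differ:
      "closure {\<phi>. \<exists>x. hp i (x - fp i \<phi>) \<noteq> hq i (x - fq i \<phi>)} = UNIV"
    and Z_density: "distributed M lborel Z (\<lambda>z. ennreal (obs_density fp hp z))"

end

(* The almost sure identity of the projected scores extends by continuity to all z, where it reads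
     w_p(z_i - f_p(z)) * a(z) = w_q(z_i - f_q(z)) * b(z)
   with w = (ln h)', a = c_i - c.grad f_p and b = c_i - c.grad f_q, so solutions of the linear
   system satisfy it trivially.  Conversely, suppose that a or b is nonzero somewhere.  Move to a
   nearby point phi at which the two conditional densities differ.  If exactly one of a, b vanishes
   at phi, then one noise density is constant; if a = b there, then the conditional densities are
   proportional, hence equal.  Otherwise f_p - f_q has derivative b - a <> 0 along c at phi, so
   moving along c its value sweeps an interval, while the signs of a and b do not change.  Hence
   the sign of w_q is invariant under all small translations, i.e. constant.  So h_q is monotone
   and positive, which is impossible for a probability density. *)

theory Submission
  imports Defs
begin

section \<open>Densities on the real line\<close>

text \<open>If \<open>h\<close> stayed at or above \<open>e\<close> on an interval of length 2/e,
  its mass there would be at least 2 > 1. The length is uniform in \<open>x\<close>, so values below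
  \<open>e\<close> occur on both sides of any point.\<close>

lemma pdf_on_real_long_interval:
  assumes "pdf_on_real h" "0 < e"
  obtains L :: real where "0 < L" "\<And>x. \<exists>y\<in>{x..x + L}. h y < e"
proof -
  have int: "(\<integral>\<^sup>+ x. ennreal (h x) \<partial>lborel) = 1"
    using assms(1) by (simp add: pdf_on_real_def)
  have "\<exists>y\<in>{x..x + 2 / e}. h y < e" for x
  proof (rule ccontr)
    assume "\<not> (\<exists>y\<in>{x..x + 2 / e}. h y < e)"
    then have ge: "e \<le> h y" if "y \<in> {x..x + 2 / e}" for y
      using that by (meson not_less)
    have "ennreal 2 = ennreal e * emeasure lborel {x..x + 2 / e}"
      using assms(2) by (simp add: ennreal_mult[symmetric] del: ennreal_numeral)
    also have "\<dots> = (\<integral>\<^sup>+ y. ennreal e * indicator {x..x + 2 / e} y \<partial>lborel)"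
      by (simp add: nn_integral_cmult_indicator)
    also have "\<dots> \<le> (\<integral>\<^sup>+ y. ennreal (h y) \<partial>lborel)"
      by (intro nn_integral_mono) (auto simp: indicator_def ge intro!: ennreal_leI)
    finally show False
      using int by simp
  qed
  then show thesis
    using that[of "2 / e"] assms(2) by auto
qed

text \<open>A value below \<open>h 0\<close> to the right of 0 rules out monotonicity; one to the
  left rules out antitonicity.\<close>

lemma pdf_on_real_not_mono:
  assumes "pdf_on_real h" "\<And>x. 0 < h x"
  shows "\<not> mono h" and "\<not> antimono h"
proof -
  obtain L where L: "0 < L" "\<And>x. \<exists>y\<in>{x..x + L}. h y < h 0"
    using pdf_on_real_long_interval[OF assms(1) assms(2)[of 0]] by metis
  obtain y y' where "y \<in> {0..L}" "h y < h 0" "y' \<in> {-L..0}" "h y' < h 0"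
    using L(2)[of 0] L(2)[of "-L"] by auto
  then show "\<not> mono h" "\<not> antimono h"
    using monoD[of h 0 y] antimonoD[of h y' 0] by force+
qed

lemma pdf_on_real_deriv_sgn_not_constant:
  assumes pdf: "pdf_on_real h" and pos: "\<And>x. 0 < h x"
    and D: "\<And>x. ((\<lambda>x. ln (h x)) has_real_derivative w x) (at x)"
    and s: "\<And>x. sgn (w x) = s"
  shows False
proof (cases "0 \<le> s")
  case True
  then have "0 \<le> w x" for x
    using s[of x] by (auto simp: sgn_real_def split: if_splits)
  then have "ln (h x) \<le> ln (h y)" if "x \<le> y" for x y
    using DERIV_nonneg_imp_nondecreasing[OF that, of "\<lambda>x. ln (h x)"] D by blast
  then show False
    using pdf_on_real_not_mono(1)[of h] pdf pos by (simp add: mono_def)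
next
  case False
  then have "w x \<le> 0" for x
    using s[of x] by (auto simp: sgn_real_def split: if_splits)
  then have "ln (h y) \<le> ln (h x)" if "x \<le> y" for x y
    using DERIV_nonpos_imp_nonincreasing[OF that, of "\<lambda>x. ln (h x)"] D by blast
  then show False
    using pdf_on_real_not_mono(2)[of h] pdf pos by (simp add: antimono_def)
qed

text \<open>Equal logarithmic derivatives make \<open>h\<close> proportional to the translate of
  \<open>k\<close>; both have mass 1, which forces the factor to be 1.\<close>

lemma pdf_on_real_eq_translateI:
  assumes h: "pdf_on_real h" "\<And>x. 0 < h x"
    and k: "pdf_on_real k" "\<And>x. 0 < k x"
    and Dh: "\<And>x. ((\<lambda>x. ln (h x)) has_real_derivative w (x + d)) (at x)"
    and Dk: "\<And>x. ((\<lambda>x. ln (k x)) has_real_derivative w x) (at x)"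
  shows "h x = k (x + d)"
proof -
  have [measurable]: "k \<in> borel_measurable borel"
    using k(1) by (simp add: pdf_on_real_def)
  have "((\<lambda>x. ln (h x) - ln (k (x + d))) has_real_derivative 0) (at x)" for x
    using DERIV_diff[OF Dh[of x] DERIV_shift[THEN iffD1, OF Dk[of "x + d"]]] by simp
  then obtain C where C: "ln (h x) - ln (k (x + d)) = C" for x
    using DERIV_isconst_all[of "\<lambda>x. ln (h x) - ln (k (x + d))"] by blast
  have hk: "h x = exp C * k (x + d)" for x
    using C[of x] h(2)[of x] k(2)[of "x + d"] by (metis diff_add_cancel exp_add exp_ln)
  have "1 = (\<integral>\<^sup>+ x. ennreal (exp C) * ennreal (k (x + d)) \<partial>lborel)"
    using h(1) by (simp add: pdf_on_real_def hk ennreal_mult' )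
  also have "\<dots> = ennreal (exp C) * (\<integral>\<^sup>+ x. ennreal (k (x + d)) \<partial>lborel)"
    by (rule nn_integral_cmult) simp
  also have "(\<integral>\<^sup>+ x. ennreal (k (x + d)) \<partial>lborel) = (\<integral>\<^sup>+ x. ennreal (k x) \<partial>lborel)"
    using nn_integral_real_affine[of "\<lambda>x. ennreal (k x)" 1 d] by (simp add: add.commute)
  finally have "exp C = 1"
    using k(1) by (simp add: pdf_on_real_def)
  then show ?thesis
    using hk by simp
qed

text \<open>The distance from x to y is cut into finitely many equal steps of length at most
  \<open>e\<close>.\<close>

lemma locally_translation_invariant_imp_constant:
  fixes g :: "real \<Rightarrow> 'a"
  assumes "0 < e" and inv: "\<And>x t. 0 \<le> t \<Longrightarrow> t \<le> e \<Longrightarrow> g (x + t) = g x"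
  shows "g x = g y"
proof -
  have le: "g y = g x" if "x \<le> y" for x y
  proof -
    obtain n :: nat where n: "y - x < real n * e"
      using reals_Archimedean3[OF assms(1)] by blast
    with that assms(1) have "n \<noteq> 0"
      by (cases n) auto
    define t where "t = (y - x) / real n"
    have t: "0 \<le> t" "t \<le> e" "real n * t = y - x"
      using that n \<open>n \<noteq> 0\<close> by (auto simp: t_def field_simps)
    have "g (x + real m * t) = g x" for m
    proof (induction m)
      case (Suc m)
      then show ?case
        using inv[OF t(1,2), of "x + real m * t"] by (simp add: algebra_simps)
    qed simp
    from this[of n] show ?thesis
      using t(3) by simp
  qed
  show ?thesis
    by (cases x y rule: le_cases) (simp_all add: le)
qed

section \<open>Gradients\<close>

lemma GDERIV_unique:
  assumes "GDERIV f z :> D" "GDERIV f z :> D'"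
  shows "D = D'"
proof -
  have "(\<lambda>h. inner h D) = (\<lambda>h. inner h D')"
    using assms unfolding gderiv_def by (rule has_derivative_unique)
  then show ?thesis
    by (metis vector_eq_ldot)
qed

lemma grad_eqI: "GDERIV f z :> D \<Longrightarrow> grad f z = D"
  unfolding grad_def by (rule the_equality) (auto intro: GDERIV_unique)

lemma cont_diff_GDERIV: "cont_diff f \<Longrightarrow> GDERIV f z :> grad f z"
  unfolding cont_diff_def using grad_eqI by metis

lemma cont_diff_continuous_grad: "cont_diff f \<Longrightarrow> continuous_on UNIV (grad f)"
proof -
  assume "cont_diff f"
  then obtain g where g: "\<And>z. GDERIV f z :> g z" "continuous_on UNIV g"
    unfolding cont_diff_def by blast
  then have "grad f = g"
    by (intro ext grad_eqI)
  then show ?thesis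
    using g by simp
qed

lemma cont_diff_continuous: "cont_diff f \<Longrightarrow> continuous_on UNIV f"
  by (meson cont_diff_GDERIV continuous_at_imp_continuous_on gderiv_def has_derivative_continuous)

lemma GDERIV_sum:
  assumes "\<And>i. i \<in> I \<Longrightarrow> GDERIV (f i) z :> D i"
  shows "GDERIV (\<lambda>z. \<Sum>i\<in>I. f i z) z :> (\<Sum>i\<in>I. D i)"
  using assms unfolding gderiv_def inner_sum_right by (intro has_derivative_sum) auto

lemma GDERIV_along_line:
  assumes "GDERIV f (z + t *\<^sub>R c) :> D"
  shows "((\<lambda>t. f (z + t *\<^sub>R c)) has_real_derivative c \<bullet> D) (at t)"
proof -
  have "((\<lambda>t. z + t *\<^sub>R c) has_derivative (\<lambda>h. h *\<^sub>R c)) (at t)"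
    by (auto intro!: derivative_eq_intros)
  from has_derivative_compose[OF this assms[unfolded gderiv_def]]
  show ?thesis
    by (simp add: has_field_derivative_def mult_commute_abs)
qed

lemma GDERIV_translate:
  assumes "GDERIV f (z + v) :> D"
  shows "GDERIV (\<lambda>z. f (z + v)) z :> D"
proof -
  have "((\<lambda>z. z + v) has_derivative (\<lambda>h. h)) (at z)"
    by (auto intro!: derivative_eq_intros)
  from has_derivative_compose[OF this assms[unfolded gderiv_def]]
  show ?thesis
    by (simp add: gderiv_def)
qed

text \<open>Used to vary z_i freely while the parent values, and so the mechanism, stay
  fixed.\<close>

lemma depends_only_on_add_axis:
  assumes "depends_only_on S f" "i \<notin> S"
  shows "f (z + axis i t) = f z"
  using assms unfolding depends_only_on_def by (auto simp: axis_def)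

lemma grad_add_axis:
  assumes "depends_only_on S f" "i \<notin> S" "cont_diff f"
  shows "grad f (z + axis i t) = grad f z"
  using GDERIV_translate[OF cont_diff_GDERIV[OF assms(3), of "z + axis i t"]]
  by (simp add: depends_only_on_add_axis[OF assms(1,2)] grad_eqI)

section \<open>A single mechanism\<close>

text \<open>Transfers positivity and C1 regularity from the conditional density to the noise
  density, which is its restriction to a line in direction i.\<close>

lemma noise_density_derivative:
  assumes S: "depends_only_on S (f i)" "i \<notin> S"
    and C1: "cont_diff (cond_density f h i)"
    and pos: "\<And>z. 0 < cond_density f h i z"
  shows "0 < h i x"
    and "\<exists>w. continuous_on UNIV w \<and> (\<forall>x. ((\<lambda>x. ln (h i x)) has_real_derivative w x) (at x))"
proof -
  \<comment> \<open>On this line \<open>f i\<close> keeps the value \<open>f i 0\<close>, and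
    coordinate i is \<open>x + f i 0\<close>, so the noise argument is exactly
    \<open>x\<close>.\<close>
  have h: "h i x = cond_density f h i (axis i (f i 0) + x *\<^sub>R axis i 1)" for x
  proof -
    have *: "axis i (f i 0) + x *\<^sub>R axis i 1 = (0 :: real ^ 'a) + axis i (x + f i 0)"
      by (simp add: vec_eq_iff axis_def)
    show ?thesis
      unfolding * cond_density_def depends_only_on_add_axis[OF S] by (simp add: axis_def)
  qed
  show pos_h: "0 < h i x" for x
    by (subst h) (rule pos)
  define h' where "h' x = axis i 1 \<bullet> grad (cond_density f h i) (axis i (f i 0) + x *\<^sub>R axis i 1)" for x
  have D: "(h i has_real_derivative h' x) (at x)" for x
    using GDERIV_along_line[OF cont_diff_GDERIV[OF C1], where c = "axis i 1"]
    by (subst h[abs_def]) (simp add: h'_def)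
  have "continuous_on UNIV h'"
    unfolding h'_def
    by (intro continuous_intros continuous_on_compose2[OF cont_diff_continuous_grad[OF C1]]) auto
  moreover have "continuous_on UNIV (h i)"
    using D by (meson DERIV_isCont continuous_at_imp_continuous_on)
  ultimately have "continuous_on UNIV (\<lambda>x. h' x / h i x)"
    using pos_h by (intro continuous_intros) (auto simp: less_le)
  moreover have "((\<lambda>x. ln (h i x)) has_real_derivative h' x / h i x) (at x)" for x
    using DERIV_chain2[OF DERIV_ln_divide[OF pos_h] D] by simp
  ultimately show
    "\<exists>w. continuous_on UNIV w \<and> (\<forall>x. ((\<lambda>x. ln (h i x)) has_real_derivative w x) (at x))"
    by blast
qed

lemma GDERIV_ln_cond_density:
  assumes "cont_diff (f i)"
    and "\<And>x. ((\<lambda>x. ln (h i x)) has_real_derivative w x) (at x)"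
  shows "GDERIV (\<lambda>z. ln (cond_density f h i z)) z :> w (z $ i - f i z) *\<^sub>R (axis i 1 - grad (f i) z)"
proof -
  have "GDERIV (\<lambda>z. z $ i) z :> axis i 1"
    using bounded_linear_imp_has_derivative[OF bounded_linear_vec_nth[of i]]
    by (simp add: gderiv_def inner_axis)
  from GDERIV_DERIV_compose[OF GDERIV_diff[OF this cont_diff_GDERIV[OF assms(1)]] assms(2)]
  show ?thesis
    by (simp add: cond_density_def)
qed

text \<open>The converse direction for one node \<open>i\<close> with parent set \<open>S\<close>:
  \<open>f\<close>, \<open>h\<close> form the observational mechanism, \<open>g\<close>,
  \<open>k\<close> the interventional one.\<close>

lemma score_identity_imp_solution:
  fixes f g :: "real ^ 'n::finite \<Rightarrow> real"
  assumes i: "i \<notin> S"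
    and f: "depends_only_on S f" "cont_diff f"
    and g: "depends_only_on S g" "cont_diff g"
    and h: "pdf_on_real h" "\<And>x. 0 < h x"
    and k: "pdf_on_real k" "\<And>x. 0 < k x"
    and Dh: "\<And>x. ((\<lambda>x. ln (h x)) has_real_derivative u x) (at x)"
    and Dk: "\<And>x. ((\<lambda>x. ln (k x)) has_real_derivative v x) (at x)"
    and dense: "closure {z. \<exists>x. h (x - f z) \<noteq> k (x - g z)} = UNIV"
    and eq: "\<And>z. u (z $ i - f z) * (c $ i - c \<bullet> grad f z) = v (z $ i - g z) * (c $ i - c \<bullet> grad g z)"
  shows "c $ i - c \<bullet> grad f z = 0 \<and> c $ i - c \<bullet> grad g z = 0"
proof (rule ccontr)
  define a where "a z = c $ i - c \<bullet> grad f z" for z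
  define b where "b z = c $ i - c \<bullet> grad g z" for z
  define d where "d z = f z - g z" for z
  assume "\<not> ?thesis"
  then have z: "a z \<noteq> 0 \<or> b z \<noteq> 0"
    by (simp add: a_def b_def)
  have cont: "continuous_on UNIV a" "continuous_on UNIV b"
    unfolding a_def b_def
    by (intro continuous_intros cont_diff_continuous_grad f g)+
  \<comment> \<open>Since \<open>a\<close>, \<open>b\<close> and \<open>d\<close> ignore z_i, that
    coordinate can be set to \<open>t + f z\<close>. The arguments of \<open>u\<close> and
    \<open>v\<close> become \<open>t\<close> and \<open>t + d z\<close>, with \<open>t\<close>
    independent of \<open>z\<close>.\<close>
  have uv: "u t * a z = v (t + d z) * b z" for t z
    using eq[of "z + axis i (t + f z - z $ i)"]
    by (simp add: a_def b_def d_def depends_only_on_add_axis[OF f(1) i] depends_only_on_add_axis[OF g(1) i]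
        grad_add_axis[OF f(1) i f(2)] grad_add_axis[OF g(1) i g(2)] algebra_simps)
  \<comment> \<open>A nonempty open set meets the dense set on which the conditional densities
    differ.\<close>
  have "open {z. a z \<noteq> 0 \<or> b z \<noteq> 0}"
    using cont by (intro open_Collect_disj open_Collect_neq) auto
  then obtain y x where y: "a y \<noteq> 0 \<or> b y \<noteq> 0" and differ: "h (x - f y) \<noteq> k (x - g y)"
    using z dense open_Int_closure_eq_empty[of "{z. a z \<noteq> 0 \<or> b z \<noteq> 0}"
        "{z. \<exists>x. h (x - f z) \<noteq> k (x - g z)}"] by blast
  have a0: "a y \<noteq> 0"
  proof
    assume "a y = 0"
    then have "v t = 0" for t
      using uv[of "t - d y" y] y by simp
    then show False
      using pdf_on_real_deriv_sgn_not_constant[OF k Dk, of 0] by simp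
  qed
  have b0: "b y \<noteq> 0"
  proof
    assume "b y = 0"
    then have "u t = 0" for t
      using uv[of t y] y by simp
    then show False
      using pdf_on_real_deriv_sgn_not_constant[OF h Dh, of 0] by simp
  qed
  \<comment> \<open>Cancelling the common factor makes \<open>u\<close> a translate of
    \<open>v\<close> by \<open>d y\<close>, so the two conditional densities would coincide at
    \<open>y\<close>.\<close>
  have ab: "a y \<noteq> b y"
  proof
    assume "a y = b y"
    then have "u t = v (t + d y)" for t
      using uv[of t y] a0 by simp
    then have "h (x - f y) = k (x - f y + d y)"
      using Dh Dk by (intro pdf_on_real_eq_translateI[OF h k, where w = v]) simp_all
    with differ show False
      by (simp add: d_def)
  qed
  define l where "l t = y + t *\<^sub>R c" for t
  have Dd: "((\<lambda>t. d (l t)) has_real_derivative b y - a y) (at 0)"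
    unfolding d_def l_def
    using DERIV_diff[OF GDERIV_along_line[of f y 0 c, OF cont_diff_GDERIV[OF f(2)]]
        GDERIV_along_line[of g y 0 c, OF cont_diff_GDERIV[OF g(2)]]]
    by (simp add: a_def b_def)
  have cl: "continuous_on UNIV l"
    unfolding l_def by (intro continuous_intros)
  have al: "isCont (\<lambda>t. a (l t)) 0" and bl: "isCont (\<lambda>t. b (l t)) 0"
    using continuous_on_compose2[OF cont(1) cl] continuous_on_compose2[OF cont(2) cl]
    by (auto simp: continuous_on_eq_continuous_at)
  have sgn_locally: "\<forall>\<^sub>F t in nhds 0. sgn (F t) = sgn (F 0)"
    if "isCont F 0" "F 0 \<noteq> 0" for F :: "real \<Rightarrow> real"
  proof -
    have "(F \<longlongrightarrow> F 0) (nhds 0)"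
      using that(1) by (simp add: isCont_def tendsto_at_iff_tendsto_nhds)
    then show ?thesis
      using order_tendstoD[of F "F 0" "nhds 0" 0] that(2)
      by (cases "F 0 > 0") (auto elim!: eventually_mono)
  qed
  have "\<forall>\<^sub>F t in nhds 0. sgn (a (l t)) = sgn (a y) \<and> sgn (b (l t)) = sgn (b y)"
    using sgn_locally[OF al] sgn_locally[OF bl] a0 b0 by (auto simp: l_def intro: eventually_conj)
  then obtain r where r: "0 < r"
    and sgns: "\<And>t. \<bar>t\<bar> < r \<Longrightarrow> sgn (a (l t)) = sgn (a y) \<and> sgn (b (l t)) = sgn (b y)"
    by (auto simp: eventually_nhds_metric)
  \<comment> \<open>Were \<open>d\<close> constant along the line near 0, its derivative
    \<open>b y - a y\<close> would vanish.\<close>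
  obtain t where t: "\<bar>t\<bar> < r" "d (l t) \<noteq> d (l 0)"
    using DERIV_local_const[OF Dd r] ab by (metis diff_0 abs_minus_cancel right_minus_eq)
  \<comment> \<open>The interval from \<open>d0\<close> to \<open>d0 + e\<close> has the two
    distinct values of \<open>d\<close> as endpoints; by connectedness \<open>d\<close> attains all
    of it while the signs of \<open>a\<close> and \<open>b\<close> stay fixed.\<close>
  define d0 where "d0 = min (d (l t)) (d (l 0))"
  define e where "e = \<bar>d (l t) - d (l 0)\<bar>"
  have attained: "\<exists>s. \<bar>s\<bar> < r \<and> d (l s) = d0 + q" if "0 \<le> q" "q \<le> e" for q
  proof -
    have "connected ((\<lambda>s. d (l s)) ` {-r<..<r})"
      unfolding d_def
      by (intro connected_continuous_image continuous_intros
          continuous_on_compose2[OF cont_diff_continuous[OF f(2)] continuous_on_subset[OF cl]]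
          continuous_on_compose2[OF cont_diff_continuous[OF g(2)] continuous_on_subset[OF cl]]) auto
    moreover have "d (l t) \<in> (\<lambda>s. d (l s)) ` {-r<..<r}" "d (l 0) \<in> (\<lambda>s. d (l s)) ` {-r<..<r}"
      using t(1) r by (auto simp: abs_less_iff intro!: imageI)
    moreover have "d0 \<le> d0 + q" "d0 + q \<le> max (d (l t)) (d (l 0))"
      using that by (auto simp: d0_def e_def)
    ultimately have "d0 + q \<in> (\<lambda>s. d (l s)) ` {-r<..<r}"
      unfolding connected_iff_interval d0_def
      by (cases "d (l t) \<le> d (l 0)") (auto simp: min_def max_def)
    then show ?thesis
      by (fastforce simp: abs_less_iff)
  qed
  \<comment> \<open>The right-hand side is free of \<open>q\<close>, so the sign of \<open>v\<close>
    does not change as its argument runs through an interval of length \<open>e\<close>.\<close>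
  have sv: "sgn (v (s + (d0 + q))) = sgn (u s) * sgn (a y) * sgn (b y)" if q: "0 \<le> q" "q \<le> e" for q s
  proof -
    obtain p where p: "\<bar>p\<bar> < r" "d (l p) = d0 + q"
      using attained[OF q] by blast
    have "sgn (u s) * sgn (a y) = sgn (v (s + (d0 + q))) * sgn (b y)"
      using uv[of s "l p"] sgns[OF p(1)] p(2) by (metis sgn_mult)
    moreover have "sgn (b y) * sgn (b y) = 1"
      using b0 by (simp add: sgn_if)
    ultimately show ?thesis
      by (metis mult.assoc mult.right_neutral)
  qed
  have "0 < e"
    using t by (simp add: e_def)
  \<comment> \<open>Compare \<open>sv\<close> for \<open>q\<close> and for 0 at the base point
    \<open>s - d0\<close>.\<close>
  moreover have "sgn (v (s + q)) = sgn (v s)" if "0 \<le> q" "q \<le> e" for s q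
    using sv[OF that, of "s - d0"] sv[of 0 "s - d0"] that by (simp add: algebra_simps)
  ultimately have "sgn (v s) = sgn (v 0)" for s
    by (rule locally_translation_invariant_imp_constant)
  then show False
    using pdf_on_real_deriv_sgn_not_constant[OF k Dk] by blast
qed

section \<open>The model\<close>

context additive_noise_model
begin

lemma not_self_parent: "i \<notin> pa i"
  using dag by (auto simp: acyclic_def)

lemmas hp_derivative = noise_density_derivative[OF fp_parents not_self_parent p_C1 p_pos]
lemmas hq_derivative = noise_density_derivative[OF fq_parents not_self_parent q_C1 q_pos]

text \<open>The log-densities are sums over nodes, and the terms of all nodes other than
  \<open>i\<close> cancel.\<close>

lemma score_difference:
  assumes Dp: "\<And>x. ((\<lambda>x. ln (hp i x)) has_real_derivative u x) (at x)"
    and Dq: "\<And>x. ((\<lambda>x. ln (hq i x)) has_real_derivative v x) (at x)"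
  shows "c \<bullet> score (obs_density fp hp) z - c \<bullet> score (int_density fp fq hp hq i) z =
    u (z $ i - fp i z) * (c $ i - c \<bullet> grad (fp i) z) - v (z $ i - fq i z) * (c $ i - c \<bullet> grad (fq i) z)"
proof -
  obtain w where w: "\<And>j x. ((\<lambda>x. ln (hp j x)) has_real_derivative w j x) (at x)"
    using hp_derivative(2) by metis
  define G where "G j = w j (z $ j - fp j z) *\<^sub>R (axis j 1 - grad (fp j) z)" for j
  have G: "GDERIV (\<lambda>z. ln (cond_density fp hp j z)) z :> G j" for j
    unfolding G_def by (rule GDERIV_ln_cond_density[where f = fp and h = hp, OF fp_C1 w])
  \<comment> \<open>\<open>w i\<close> and \<open>u\<close> come from separate choices; uniqueness
    of gradients identifies their contributions.\<close>
  have Gi: "G i = u (z $ i - fp i z) *\<^sub>R (axis i 1 - grad (fp i) z)"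
    using GDERIV_unique[OF G GDERIV_ln_cond_density[where f = fp and h = hp, OF fp_C1 Dp]] .
  have rest: "GDERIV (\<lambda>z. \<Sum>j\<in>J. ln (cond_density fp hp j z)) z :> (\<Sum>j\<in>J. G j)" for J
    by (rule GDERIV_sum) (rule G)
  have obs: "(\<lambda>z. ln (obs_density fp hp z)) = (\<lambda>z. \<Sum>j\<in>UNIV. ln (cond_density fp hp j z))"
    unfolding obs_density_def using p_pos by (intro ext ln_prod) (auto simp: less_le)
  have int: "(\<lambda>z. ln (int_density fp fq hp hq i z)) =
      (\<lambda>z. ln (cond_density fq hq i z) + (\<Sum>j\<in>UNIV - {i}. ln (cond_density fp hp j z)))"
    unfolding int_density_def
    by (intro ext, subst ln_mult_pos, simp_all add: q_pos p_pos prod_pos)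
       (subst ln_prod, auto simp: p_pos less_imp_neq[OF p_pos, symmetric])
  have "score (obs_density fp hp) z = G i + (\<Sum>j\<in>UNIV - {i}. G j)"
    unfolding score_def obs grad_eqI[OF rest] by (simp add: sum.remove)
  moreover have "score (int_density fp fq hp hq i) z =
      v (z $ i - fq i z) *\<^sub>R (axis i 1 - grad (fq i) z) + (\<Sum>j\<in>UNIV - {i}. G j)"
    unfolding score_def int
    by (rule grad_eqI, rule GDERIV_add[OF GDERIV_ln_cond_density[where f = fq and h = hq, OF fq_C1 Dq] rest])
  ultimately show ?thesis
    by (simp add: Gi inner_add_right inner_diff_right inner_axis)
qed

text \<open>As the density of \<open>Z\<close> is positive everywhere, almost surely means Lebesgue
  almost everywhere, and a closed set of full Lebesgue measure is the whole space.\<close>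

lemma AE_Z_closed_iff:
  assumes "closed {z. P z}"
  shows "(AE \<omega> in M. P (Z \<omega>)) \<longleftrightarrow> (\<forall>z. P z)"
proof
  have [measurable]: "Measurable.pred borel P"
    using assms by (simp add: pred_def borel_closed)
  assume "AE \<omega> in M. P (Z \<omega>)"
  moreover have "0 < obs_density fp hp z" for z
    unfolding obs_density_def by (simp add: prod_pos p_pos)
  ultimately have "AE z in lborel. P z"
    by (subst (asm) distributed_AE2[OF Z_density]) auto
  then have "AE z in lebesgue. z \<in> {z. P z}"
    by (simp add: AE_completion_iff)
  then show "\<forall>z. P z"
    using mem_closed_if_AE_lebesgue[OF assms] by blast
qed simp

text \<open>Continuity of the logarithmic derivatives and gradients makes the identity a closed
  condition. With this equivalence for each \<open>i\<close> and \<open>c\<close>, (a) and (b) are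
  contrapositives of each other.\<close>

lemma AE_scores_eq_iff_solves_system:
  "(AE \<omega> in M. c \<bullet> score (obs_density fp hp) (Z \<omega>) = c \<bullet> score (int_density fp fq hp hq i) (Z \<omega>))
    \<longleftrightarrow> solves_system fp fq i c"
proof -
  obtain u v where u: "continuous_on UNIV u" "\<And>x. ((\<lambda>x. ln (hp i x)) has_real_derivative u x) (at x)"
    and v: "continuous_on UNIV v" "\<And>x. ((\<lambda>x. ln (hq i x)) has_real_derivative v x) (at x)"
    using hp_derivative(2) hq_derivative(2) by metis
  let ?P = "\<lambda>z. u (z $ i - fp i z) * (c $ i - c \<bullet> grad (fp i) z) =
    v (z $ i - fq i z) * (c $ i - c \<bullet> grad (fq i) z)"
  have "(c \<bullet> score (obs_density fp hp) z = c \<bullet> score (int_density fp fq hp hq i) z) \<longleftrightarrow> ?P z" for z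
    using score_difference[OF u(2) v(2), of c z] by linarith
  moreover have "closed {z. ?P z}"
    by (intro closed_Collect_eq continuous_intros cont_diff_continuous_grad cont_diff_continuous
        continuous_on_compose2[OF u(1)] continuous_on_compose2[OF v(1)] fp_C1 fq_C1) auto
  ultimately have "(AE \<omega> in M. c \<bullet> score (obs_density fp hp) (Z \<omega>)
      = c \<bullet> score (int_density fp fq hp hq i) (Z \<omega>)) \<longleftrightarrow> (\<forall>z. ?P z)"
    using AE_Z_closed_iff[of ?P] by simp
  also have "\<dots> \<longleftrightarrow> solves_system fp fq i c"
  proof
    assume "\<forall>z. ?P z"
    then show "solves_system fp fq i c"
      unfolding solves_system_def
      using score_identity_imp_solution[OF not_self_parent fp_parents fp_C1 fq_parents fq_C1
          hp_pdf hp_derivative(1) hq_pdf hq_derivative(1) u(2) v(2) p_q_differ]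
      by blast
  qed (simp add: solves_system_def)
  finally show ?thesis .
qed

end

theorem theorem1:
  fixes M :: "'w measure"
    and Z :: "'w \<Rightarrow> real ^ 'n::finite"
    and pa :: "'n \<Rightarrow> 'n set"
    and fp fq :: "'n \<Rightarrow> real ^ 'n \<Rightarrow> real"
    and hp hq :: "'n \<Rightarrow> real \<Rightarrow> real"
  assumes "additive_noise_model M Z pa fp fq hp hq"
  shows "(\<forall>i. \<forall>c \<in> pa_coeff_vectors pa i.
            \<not> (AE \<omega> in M. c \<bullet> score (obs_density fp hp) (Z \<omega>)
                        = c \<bullet> score (int_density fp fq hp hq i) (Z \<omega>)))
       \<longleftrightarrow>
         (\<forall>i. \<forall>c. solves_system fp fq i c \<longrightarrow> c \<notin> pa_coeff_vectors pa i)"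
  using additive_noise_model.AE_scores_eq_iff_solves_system[OF assms] by blast

end
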